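(* Let $q$ be a prime power, $d\ge 1$ an integer, let $E \subset \mathbb{F}_q^d$, and let $C$ be a real number with $1<C<|E|$. Then $$\#\{y \in \mathbb{F}_q^d:|\pi^y(E)| < C^{-1}|E|\} < (C-1)^{-1}q|E|.$$
   Context: $\mathbb{F}_q$ is the finite field with $q$ elements. For a field $\mathbb{F}$ and a point $y\in\mathbb{F}^d$, the radial projection $\pi^y$ maps each point $x\neq y$ of $\mathbb{F}^d$ to the (affine) line containing $x$ and $y$. For $E\subset\mathbb{F}^d$, $\pi^y(E)=\{\pi^y(x): x\in E\setminus\{y\}\}$; thus $|\pi^y(E)|$ is the number of lines through $y$ that contain at least one point of $E\setminus\{y\}$. *)

theory Defs
  imports "HOL-Analysis.Analysis"
begin

text \<open>The library's \<open>affine hull\<close> is restricted to real vector spaces, so lines over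
  an arbitrary field are introduced directly. For \<open>x = y\<close> the set below degenerates to a point.\<close>

definition affine_line :: "'a::field ^ 'n \<Rightarrow> 'a ^ 'n \<Rightarrow> ('a ^ 'n) set" where
  "affine_line x y = {x + t *s (y - x) | t. True}"

text \<open>The map \<open>\<pi>\<^sup>y\<close>, whose values are lines regarded as point sets; it is only
  meaningful at points \<open>x \<noteq> y\<close>.\<close>

definition radial_proj :: "'a::field ^ 'n \<Rightarrow> 'a ^ 'n \<Rightarrow> ('a ^ 'n) set" where
  "radial_proj y x = affine_line x y"

definition radial_image :: "'a::field ^ 'n \<Rightarrow> ('a ^ 'n) set \<Rightarrow> ('a ^ 'n) set set" where
  "radial_image y E = radial_proj y ` (E - {y})"

end

theory Submission
  imports Defs
begin

text \<open>The proof is a second-moment double count of the triples \<open>(y, x, x')\<close> in which \<open>x \<noteq> x'\<close> are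
  points of \<open>E\<close> and \<open>y\<close> lies on the line through them. Write \<open>N\<close> for the size of \<open>E\<close> and \<open>q\<close> for
  the size of the field.

  A line has at most \<open>q\<close> points, so there are at most \<open>q * N * (N - 1)\<close> such triples
  (\<open>sum_collinear_pairs_le\<close>). On the other hand, two points of \<open>E - {y}\<close> with the same radial
  projection are collinear with \<open>y\<close>, and by Cauchy--Schwarz a map with few values has many
  collisions (\<open>card_squared_le_card_image_mult_collisions\<close>). If \<open>y\<close> is outside \<open>E\<close> and sees fewer
  than \<open>N / C\<close> directions, this gives at least \<open>C * N\<close> ordered collisions, of which \<open>N\<close> are
  trivial, hence \<open>(C - 1) * N\<close> triples over \<open>y\<close>. If \<open>y\<close> lies in \<open>E\<close>, the projection acts on only
  \<open>N - 1\<close> points, but the loss is made up by the pairs that have \<open>y\<close> as a member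
  (\<open>card_collinear_pairs_ge\<close>). Comparing the two counts bounds the number of exceptional points
  by \<open>q * (N - 1) / (C - 1)\<close>, and the slack between \<open>N - 1\<close> and \<open>N\<close> makes the final inequality
  strict.\<close>

definition collinear_pairs :: "('a::field ^ 'n) set \<Rightarrow> 'a ^ 'n \<Rightarrow> (('a ^ 'n) \<times> ('a ^ 'n)) set" where
  "collinear_pairs E y = {(x, x'). x \<in> E \<and> x' \<in> E \<and> x \<noteq> x' \<and> y \<in> affine_line x x'}"

lemma left_mem_affine_line: "x \<in> affine_line x y"
  unfolding affine_line_def by (auto intro!: exI[of _ 0])

lemma right_mem_affine_line: "y \<in> affine_line x y"
  unfolding affine_line_def by (auto intro!: exI[of _ 1])

lemma card_affine_line_le:
  fixes x y :: "'a::{field,finite} ^ 'n"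
  shows "card (affine_line x y) \<le> CARD('a)"
proof -
  have "affine_line x y = range (\<lambda>t. x + t *s (y - x))"
    by (auto simp: affine_line_def)
  then show ?thesis
    by (simp add: card_image_le)
qed

lemma mem_affine_line_if_radial_proj_eq:
  assumes eq: "radial_proj y x = radial_proj y x'" and "x \<noteq> x'"
  shows "y \<in> affine_line x x'"
proof -
  have "x' \<in> affine_line x y"
    using eq left_mem_affine_line[of x' y] by (simp add: radial_proj_def)
  then obtain t where t: "x' = x + t *s (y - x)"
    by (auto simp: affine_line_def)
  with \<open>x \<noteq> x'\<close> have "t \<noteq> 0"
    by auto
  then have "y = x + inverse t *s (x' - x)"
    by (simp add: t)
  then show ?thesis
    unfolding affine_line_def by blast
qed

text \<open>Cauchy--Schwarz for the fibre sizes of \<open>f\<close>: they add up to the size of \<open>A\<close>, and their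
  squares add up to the number of ordered collisions, the diagonal included.\<close>

lemma card_squared_le_card_image_mult_collisions:
  assumes "finite A"
  shows "(card A)\<^sup>2 \<le> card (f ` A) * card {(x, x'). x \<in> A \<and> x' \<in> A \<and> f x = f x'}"
proof -
  let ?fib = "\<lambda>v. {x \<in> A. f x = v}"
  have "A = (\<Union>v\<in>f ` A. ?fib v)"
    by auto
  also have "card \<dots> = (\<Sum>v\<in>f ` A. card (?fib v))"
    using assms by (intro card_UN_disjoint) auto
  finally have A: "card A = (\<Sum>v\<in>f ` A. card (?fib v))" .
  have "{(x, x'). x \<in> A \<and> x' \<in> A \<and> f x = f x'} = (\<Union>v\<in>f ` A. ?fib v \<times> ?fib v)"
    by auto
  also have "card \<dots> = (\<Sum>v\<in>f ` A. card (?fib v \<times> ?fib v))"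
    using assms by (intro card_UN_disjoint) auto
  finally have coll: "card {(x, x'). x \<in> A \<and> x' \<in> A \<and> f x = f x'} = (\<Sum>v\<in>f ` A. (card (?fib v))\<^sup>2)"
    by (simp add: card_cartesian_product power2_eq_square)
  have "real ((card A)\<^sup>2) \<le> real (card (f ` A) * (\<Sum>v\<in>f ` A. (card (?fib v))\<^sup>2))"
    using sum_squared_le_sum_of_squares[of "\<lambda>v. real (card (?fib v))" "f ` A"]
    by (simp add: A mult.commute)
  then show ?thesis
    unfolding coll by linarith
qed

text \<open>Exchanging the order of summation, each ordered pair of distinct points of \<open>E\<close> is counted
  once for every point of its line.\<close>

lemma sum_collinear_pairs_le:
  fixes E :: "('a::{field,finite} ^ 'n::finite) set"
  shows "(\<Sum>y\<in>UNIV. card (collinear_pairs E y)) \<le> CARD('a) * (card E * (card E - 1))"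
proof -
  let ?P = "{(x, x'). x \<in> E \<and> x' \<in> E \<and> x \<noteq> x'}"
  have "?P = (SIGMA x:E. E - {x})"
    by auto
  then have P: "card ?P = card E * (card E - 1)"
    by simp
  have "(\<Sum>y\<in>UNIV. card (collinear_pairs E y)) = (\<Sum>y\<in>UNIV. card {p \<in> ?P. y \<in> affine_line (fst p) (snd p)})"
    by (intro sum.cong refl arg_cong[where f = card]) (auto simp: collinear_pairs_def)
  also have "\<dots> = (\<Sum>p\<in>?P. card {y \<in> UNIV. y \<in> affine_line (fst p) (snd p)})"
    by (rule sum_multicount_gen[symmetric]) auto
  also have "\<dots> \<le> (\<Sum>p\<in>?P. CARD('a))"
    by (intro sum_mono) (simp add: card_affine_line_le)
  finally show ?thesis
    by (simp add: P mult.commute)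
qed

text \<open>The pairs come from the off-diagonal collisions of the projection on \<open>F = E - {y}\<close>. When \<open>y\<close>
  belongs to \<open>E\<close>, these alone can be too few; the \<open>2 * (N - 1)\<close> pairs that contain \<open>y\<close> are
  disjoint from them and close the gap.\<close>

lemma card_collinear_pairs_ge:
  fixes E :: "('a::{field,finite} ^ 'n::finite) set" and C :: real
  assumes "1 < C" and C_less: "C < real (card E)"
    and few: "real (card (radial_image y E)) < inverse C * real (card E)"
  shows "(C - 1) * real (card E) \<le> real (card (collinear_pairs E y))"
proof -
  define F where "F = E - {y}"
  define K where "K = {(x, x'). x \<in> F \<and> x' \<in> F \<and> radial_proj y x = radial_proj y x'}"
  define D where "D = K - (\<lambda>x. (x, x)) ` F"
  define N where "N = real (card E)"
  have fin: "finite F" "finite K" "finite D"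
    by auto
  have "card D = card K - card ((\<lambda>x. (x, x)) ` F)"
    unfolding D_def by (rule card_Diff_subset) (auto simp: K_def)
  moreover have "card ((\<lambda>x. (x, x)) ` F) = card F"
    by (simp add: card_image inj_on_def)
  moreover have "card ((\<lambda>x. (x, x)) ` F) \<le> card K"
    by (rule card_mono) (auto simp: K_def)
  ultimately have D: "real (card D) = real (card K) - real (card F)"
    by simp
  have DW: "D \<subseteq> collinear_pairs E y"
    by (auto simp: D_def K_def F_def collinear_pairs_def intro: mem_affine_line_if_radial_proj_eq)
  have "real ((card F)\<^sup>2) \<le> real (card (radial_image y E) * card K)"
    using card_squared_le_card_image_mult_collisions[OF fin(1), of "radial_proj y"]
    unfolding radial_image_def K_def F_def of_nat_le_iff .
  also have "\<dots> \<le> inverse C * N * real (card K)"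
    using few by (simp add: N_def mult_right_mono)
  finally have K: "C * (real (card F))\<^sup>2 \<le> N * real (card K)"
    using \<open>1 < C\<close> by (simp add: field_simps)
  have N: "C < N" "0 < N"
    using assms by (auto simp: N_def)
  show ?thesis
  proof (cases "y \<in> E")
    case False
    then have "real (card F) = N"
      by (simp add: F_def N_def)
    with K N have "C * N \<le> real (card K)"
      by (simp add: power2_eq_square)
    moreover have "card D \<le> card (collinear_pairs E y)"
      by (rule card_mono[OF _ DW]) simp
    ultimately show ?thesis
      using D \<open>real (card F) = N\<close> by (simp add: N_def algebra_simps)
  next
    case True
    then have F: "real (card F) = N - 1"
      using N by (simp add: F_def N_def of_nat_diff)
    have "D \<union> ({y} \<times> F \<union> F \<times> {y}) \<subseteq> collinear_pairs E y"
      using DW True left_mem_affine_line right_mem_affine_line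
      by (auto simp: F_def collinear_pairs_def)
    then have "card (D \<union> ({y} \<times> F \<union> F \<times> {y})) \<le> card (collinear_pairs E y)"
      by (rule card_mono[rotated]) simp
    moreover have "card (D \<union> ({y} \<times> F \<union> F \<times> {y})) = card D + card ({y} \<times> F \<union> F \<times> {y})"
      by (rule card_Un_disjoint) (auto simp: D_def K_def F_def)
    moreover have "card ({y} \<times> F \<union> F \<times> {y}) = card ({y} \<times> F) + card (F \<times> {y})"
      by (rule card_Un_disjoint) (auto simp: F_def)
    ultimately have W: "real (card K) + (N - 1) \<le> real (card (collinear_pairs E y))"
      using D F by (simp add: card_cartesian_product)
    \<comment> \<open>Multiplied by \<open>N\<close>, the lower bound \<open>C * (N - 1)\<^sup>2 / N + (N - 1)\<close> exceeds \<open>(C - 1) * N\<close> by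
      \<open>(2 * N - 1) * (N - C)\<close>; the hypothesis \<open>C < N\<close> is what makes this nonnegative.\<close>
    have "0 \<le> (2 * N - 1) * (N - C)"
      using N \<open>1 < C\<close> by simp
    then have "N * ((C - 1) * N) \<le> C * (N - 1)\<^sup>2 + N * (N - 1)"
      by (simp add: power2_eq_square algebra_simps)
    also have "\<dots> \<le> N * (real (card K) + (N - 1))"
      using K F by (simp add: algebra_simps)
    finally have "(C - 1) * N \<le> real (card K) + (N - 1)"
      using N by simp
    with W show ?thesis
      by (simp add: N_def)
  qed
qed

theorem theorem1p5:
  fixes E :: "('a::{field,finite} ^ 'n::finite) set" and C :: real
  assumes "1 < C" and "C < real (card E)"
  shows "real (card {y :: 'a ^ 'n. real (card (radial_image y E)) < inverse C * real (card E)})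
    < inverse (C - 1) * real CARD('a) * real (card E)"
proof -
  define Y where "Y = {y :: 'a ^ 'n. real (card (radial_image y E)) < inverse C * real (card E)}"
  define N where "N = real (card E)"
  define q where "q = real CARD('a)"
  have N: "1 < N" and q: "0 < q"
    using assms by (auto simp: N_def q_def)
  have "real (card Y) * ((C - 1) * N) = (\<Sum>y\<in>Y. (C - 1) * N)"
    by simp
  also have "\<dots> \<le> (\<Sum>y\<in>Y. real (card (collinear_pairs E y)))"
    using card_collinear_pairs_ge[OF assms] by (intro sum_mono) (simp add: Y_def N_def)
  also have "\<dots> \<le> (\<Sum>y\<in>UNIV. real (card (collinear_pairs E y)))"
    by (intro sum_mono2) auto
  also have "\<dots> = real (\<Sum>y\<in>UNIV. card (collinear_pairs E y))"
    by simp
  also have "\<dots> \<le> real (CARD('a) * (card E * (card E - 1)))"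
    using sum_collinear_pairs_le[of E] by (simp only: of_nat_le_iff)
  also have "\<dots> = q * (N * (N - 1))"
    using N by (simp add: q_def N_def of_nat_diff)
  also have "\<dots> < q * (N * N)"
    using N q by simp
  finally have "(real (card Y) * (C - 1)) * N < (q * N) * N"
    by (simp add: mult.assoc)
  then have "real (card Y) * (C - 1) < q * N"
    using N by simp
  then show ?thesis
    using assms(1) by (simp add: Y_def N_def q_def field_simps)
qed

end
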